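(* Let $H$ be a finite abelian group with $d(H)>2$. Then $d(H)=4$ and $H\cong C_n\times C_n\times G$, where $n$ is a power of $3$ and $G$ is either the trivial group or an abelian Beauville group.
   Context: $C_n$ denotes the cyclic group of order $n$. For a finite group $G$ and $x,y\in G$, let $\Sigma(x,y)=\bigcup_{i=1}^{|G|}\bigcup_{k\in G}\{(x^i)^k,(y^i)^k,((xy)^i)^k\}$, where $g^k$ for $k \in G$ denotes the conjugate of $g$ by $k$; that is, $\Sigma(x,y)$ is the union of all conjugates in $G$ of the cyclic subgroups $\langle x\rangle,\langle y\rangle,\langle xy\rangle$. The Beauville dimension $d(G)$ of a finite group $G$ is the minimum number $d$ of sets $\Sigma(x_i,y_i)$ ($i=1,\dots,d$), with $\langle x_i,y_i\rangle=G$ for every $i$, such that $\bigcap_{i=1}^d\Sigma(x_i,y_i)=\{e\}$. If there is a non-identity element of $G$ contained in every set $\Sigma(x,y)$ with $\langle x,y\rangle=G$ (this holds vacuously if $G$ is not generated by two elements), then $d(G)=1$ by convention. A Beauville group is a finite group $G$ with $d(G)=2$, i.e. a non-trivial finite group having two generating pairs $(x_1,y_1),(x_2,y_2)$ with $\Sigma(x_1,y_1)\cap\Sigma(x_2,y_2)=\{e\}$. *)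

theory Defs
  imports "HOL-Algebra.Algebra"
begin

definition conj_by :: "('a, 'b) monoid_scheme \<Rightarrow> 'a \<Rightarrow> 'a \<Rightarrow> 'a" where
  "conj_by G g k = inv\<^bsub>G\<^esub> k \<otimes>\<^bsub>G\<^esub> g \<otimes>\<^bsub>G\<^esub> k"

definition Sigma_set :: "('a, 'b) monoid_scheme \<Rightarrow> 'a \<Rightarrow> 'a \<Rightarrow> 'a set" where
  "Sigma_set G x y =
     (\<Union>i\<in>{1..order G}. \<Union>k\<in>carrier G.
        {conj_by G (x [^]\<^bsub>G\<^esub> i) k,
         conj_by G (y [^]\<^bsub>G\<^esub> i) k,
         conj_by G ((x \<otimes>\<^bsub>G\<^esub> y) [^]\<^bsub>G\<^esub> i) k})"

definition generating_pair :: "('a, 'b) monoid_scheme \<Rightarrow> 'a \<Rightarrow> 'a \<Rightarrow> bool" where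
  "generating_pair G x y \<longleftrightarrow>
     x \<in> carrier G \<and> y \<in> carrier G \<and> generate G {x, y} = carrier G"

text \<open>
  The condition \<open>d \<ge> 1\<close> excludes the intersection of an empty family.
  In a finite group, when the first branch does not apply, such a \<open>d\<close> exists, so the
  least element is well defined; the trivial group has dimension 1.
\<close>

definition beauville_dim :: "('a, 'b) monoid_scheme \<Rightarrow> nat" where
  "beauville_dim G =
     (if \<exists>g\<in>carrier G. g \<noteq> \<one>\<^bsub>G\<^esub> \<and> (\<forall>x y. generating_pair G x y \<longrightarrow> g \<in> Sigma_set G x y)
      then 1
      else LEAST d. d \<ge> 1 \<and>
             (\<exists>x y :: nat \<Rightarrow> 'a.
                (\<forall>i\<in>{1..d}. generating_pair G (x i) (y i)) \<and>
                (\<Inter>i\<in>{1..d}. Sigma_set G (x i) (y i)) = {\<one>\<^bsub>G\<^esub>}))"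

definition beauville_group :: "('a, 'b) monoid_scheme \<Rightarrow> bool" where
  "beauville_group G \<longleftrightarrow> group G \<and> finite (carrier G) \<and> beauville_dim G = 2"

end

theory Submission
  imports Defs
begin

text \<open>
  Let \<open>e\<close> be the exponent of \<open>H\<close> and suppose that no non-identity element lies in every
  \<open>\<Sigma>(x, y)\<close>. For a prime \<open>p\<close> dividing \<open>e\<close>, the image of the \<open>e/p\<close>-th power map is not cyclic:
  it would have order \<open>p\<close>, and every generating pair would contain an element whose powers include
  it. Hence every generating pair is a basis of \<open>H \<cong> C\<^sub>e \<times> C\<^sub>e\<close>. If \<open>e\<close> were even, every
  \<open>\<Sigma>(x, y)\<close> would contain all three involutions, so \<open>e\<close> is odd.

  Writing \<open>H\<close> additively with basis \<open>x, y\<close>, each \<open>\<Sigma>\<close> is a union of three lines, and two lines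
  meet trivially if their determinant is prime to \<open>e\<close>. If \<open>e\<close> is prime to 6, the lines of
  \<open>(1,0), (0,1), (1,1)\<close> and \<open>(1,2), (1,-1), (2,1)\<close> show that the dimension is at most 2; for odd
  \<open>e\<close> four explicit pairs give at most 4. If \<open>3\<close> divides \<open>e\<close>, each \<open>\<Sigma>\<close> contains all but one of
  the four subgroups of order 3, so fewer than four of them always share a non-identity element.
\<close>

section \<open>Integer combinations of two elements, generation and \<open>Sigma_set\<close> in
  abelian groups\<close>

definition (in monoid) comb :: "'a \<Rightarrow> 'a \<Rightarrow> int \<Rightarrow> int \<Rightarrow> 'a" where
  "comb x y a b = x [^] a \<otimes> y [^] b"

context comm_group
begin

lemma comb_closed [simp, intro]:
  assumes "x \<in> carrier G" "y \<in> carrier G"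
  shows "comb x y a b \<in> carrier G"
  using assms by (simp add: comb_def)

lemma comb_simps [simp]:
  assumes "x \<in> carrier G" "y \<in> carrier G"
  shows "comb x y 0 0 = \<one>" "comb x y 1 0 = x" "comb x y 0 1 = y"
  using assms by (simp_all add: comb_def)

lemma comb_mult:
  assumes "x \<in> carrier G" "y \<in> carrier G"
  shows "comb x y a b \<otimes> comb x y c d = comb x y (a + c) (b + d)"
  using assms by (simp add: comb_def int_pow_mult m_ac)

lemma comb_pow:
  assumes "x \<in> carrier G" "y \<in> carrier G"
  shows "comb x y a b [^] (k::int) = comb x y (a * k) (b * k)"
  using assms by (simp add: comb_def int_pow_mult_distrib int_pow_pow m_comm)

lemma comb_eq_iff:
  assumes "x \<in> carrier G" "y \<in> carrier G"
  shows "comb x y a b = comb x y c d \<longleftrightarrow> comb x y (a - c) (b - d) = \<one>"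
proof -
  have "comb x y a b = comb x y (a - c) (b - d) \<otimes> comb x y c d"
    using assms by (simp add: comb_mult)
  then show ?thesis using assms by simp
qed

lemma generate_pair_eq:
  assumes "x \<in> carrier G" "y \<in> carrier G"
  shows "generate G {x, y} = {comb x y a b | a b. True}"
proof (rule equalityI)
  have "subgroup {comb x y a b | a b. True} G"
  proof (rule subgroupI)
    show "inv g \<in> {comb x y a b | a b. True}" if "g \<in> {comb x y a b | a b. True}" for g
    proof -
      from that obtain a b where g: "g = comb x y a b" by auto
      have "comb x y (-a) (-b) \<otimes> g = \<one>" using assms by (simp add: g comb_mult)
      then have "inv g = comb x y (-a) (-b)"
        using assms g by (intro inv_equality) auto
      then show ?thesis by auto
    qed
  next
    show "g \<otimes> h \<in> {comb x y a b | a b. True}"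
      if "g \<in> {comb x y a b | a b. True}" "h \<in> {comb x y a b | a b. True}" for g h
      using that assms comb_mult by blast
  qed (use assms in auto)
  moreover have "{x, y} \<subseteq> {comb x y a b | a b. True}"
    using comb_simps(2,3)[OF assms] by (metis (mono_tags, lifting) insert_subset mem_Collect_eq empty_subsetI)
  ultimately show "generate G {x, y} \<subseteq> {comb x y a b | a b. True}"
    by (intro generate_subgroup_incl)
next
  have sg: "subgroup (generate G {x, y}) G" using assms by (intro generate_is_subgroup) auto
  show "{comb x y a b | a b. True} \<subseteq> generate G {x, y}"
  proof clarify
    fix a b
    have "x [^] (a::int) \<in> generate G {x, y}" "y [^] (b::int) \<in> generate G {x, y}"
      using subgroup_int_pow_closed[OF sg] by (auto intro: generate.incl)
    then show "comb x y a b \<in> generate G {x, y}"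
      unfolding comb_def by (rule generate.eng)
  qed
qed

lemma generating_pair_iff:
  "generating_pair G x y \<longleftrightarrow>
     x \<in> carrier G \<and> y \<in> carrier G \<and> (\<forall>g\<in>carrier G. \<exists>a b. g = comb x y a b)"
  unfolding generating_pair_def using generate_pair_eq[of x y] by auto

text \<open>Exponents matter only modulo the group order, so the bounded exponents of
  \<open>Sigma_set\<close> can be traded for arbitrary integers.\<close>

lemma pow_upto_order_iff:
  assumes "finite (carrier G)" "u \<in> carrier G"
  shows "(\<exists>i\<in>{1..order G}. g = u [^] i) \<longleftrightarrow> (\<exists>k::int. g = u [^] k)"
proof
  assume "\<exists>i\<in>{1..order G}. g = u [^] i"
  then show "\<exists>k::int. g = u [^] k" by (metis int_pow_int)
next
  assume "\<exists>k::int. g = u [^] k"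
  then obtain k :: int where k: "g = u [^] k" by auto
  let ?n = "int (order G)"
  have n: "?n > 0" using assms by (simp add: order_gt_0_iff_finite)
  have one: "u [^] (?n * j) = \<one>" for j
    using assms int_pow_pow[of u ?n j] by (simp add: int_pow_int pow_order_eq_1)
  \<comment> \<open>The shift by one puts the representative of \<open>k\<close> in
    1..\<open>?n\<close> instead of 0..\<open>?n\<close> - 1, as the range of exponents
    requires.\<close>
  define i where "i = (k - 1) mod ?n + 1"
  have k': "k = i + ?n * ((k - 1) div ?n)" by (simp add: i_def algebra_simps)
  have "u [^] k = u [^] i \<otimes> u [^] (?n * ((k - 1) div ?n))"
    using assms(2) by (subst k') (rule int_pow_mult)
  then have "g = u [^] i" using one k assms by simp
  moreover have "1 \<le> i" "i \<le> ?n"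
    unfolding i_def using pos_mod_bound[OF n, of "k - 1"] pos_mod_sign[OF n, of "k - 1"] by linarith+
  ultimately have "g = u [^] nat i" "nat i \<in> {1..order G}"
    by (auto simp: nat_le_iff simp flip: int_pow_int)
  then show "\<exists>i\<in>{1..order G}. g = u [^] i" by blast
qed

text \<open>Conjugation is trivial in an abelian group, so only the three cyclic subgroups
  remain.\<close>

lemma Sigma_set_iff:
  assumes "finite (carrier G)" "u \<in> carrier G" "v \<in> carrier G"
  shows "g \<in> Sigma_set G u v \<longleftrightarrow>
    (\<exists>k::int. g = u [^] k) \<or> (\<exists>k::int. g = v [^] k) \<or> (\<exists>k::int. g = (u \<otimes> v) [^] k)"
proof -
  have conj: "conj_by G w k = w" if "w \<in> carrier G" "k \<in> carrier G" for w k
    using that by (simp add: conj_by_def m_comm[of "inv k" w] m_assoc)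
  have "g \<in> Sigma_set G u v \<longleftrightarrow> (\<exists>i\<in>{1..order G}. \<exists>k\<in>carrier G.
      g = conj_by G (u [^] i) k \<or> g = conj_by G (v [^] i) k \<or> g = conj_by G ((u \<otimes> v) [^] i) k)"
    unfolding Sigma_set_def by auto
  also have "\<dots> \<longleftrightarrow> (\<exists>i\<in>{1..order G}. g = u [^] i \<or> g = v [^] i \<or> g = (u \<otimes> v) [^] i)"
    using assms by (intro bex_cong refl) (auto simp: conj intro!: bexI[of _ \<one>])
  also have "\<dots> \<longleftrightarrow> (\<exists>i\<in>{1..order G}. g = u [^] i) \<or> (\<exists>i\<in>{1..order G}. g = v [^] i)
      \<or> (\<exists>i\<in>{1..order G}. g = (u \<otimes> v) [^] i)"
    by blast
  finally show ?thesis
    using assms by (simp only: pow_upto_order_iff m_closed)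
qed

lemma Sigma_set_comb_iff:
  assumes "finite (carrier G)" "x \<in> carrier G" "y \<in> carrier G"
  shows "g \<in> Sigma_set G (comb x y a b) (comb x y c d) \<longleftrightarrow>
    (\<exists>k. g = comb x y (a * k) (b * k)) \<or> (\<exists>k. g = comb x y (c * k) (d * k)) \<or>
    (\<exists>k. g = comb x y ((a + c) * k) ((b + d) * k))"
  using assms by (simp add: Sigma_set_iff comb_pow comb_mult)

lemma comb_in_Sigma_set:
  assumes "finite (carrier G)" "u \<in> carrier G" "v \<in> carrier G"
  shows "comb u v k 0 \<in> Sigma_set G u v" "comb u v 0 k \<in> Sigma_set G u v"
    "comb u v k k \<in> Sigma_set G u v"
proof -
  have "comb u v k k = (u \<otimes> v) [^] k"
    using assms by (simp add: comb_def int_pow_mult_distrib m_comm)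
  then show "comb u v k 0 \<in> Sigma_set G u v" "comb u v 0 k \<in> Sigma_set G u v"
    "comb u v k k \<in> Sigma_set G u v"
    using assms by (auto simp: Sigma_set_iff) (auto simp: comb_def)
qed

lemma one_in_Sigma_set:
  assumes "finite (carrier G)" "u \<in> carrier G" "v \<in> carrier G"
  shows "\<one> \<in> Sigma_set G u v"
  using assms int_pow_0[of G u] by (metis Sigma_set_iff)

end

section \<open>Groups with a basis \<open>x\<close>, \<open>y\<close>, treated as pairs of
  coordinates modulo \<open>n\<close>\<close>

locale homocyclic_basis = comm_group G for G (structure) +
  fixes x y :: 'a and n :: nat
  assumes fin: "finite (carrier G)"
    and gen: "generating_pair G x y"
    and comb_one_iff: "\<And>a b. comb x y a b = \<one> \<longleftrightarrow> int n dvd a \<and> int n dvd b"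
begin

lemma xy_closed [simp]: "x \<in> carrier G" "y \<in> carrier G"
  using gen by (auto simp: generating_pair_def)

lemma surj: "g \<in> carrier G \<Longrightarrow> \<exists>a b. g = comb x y a b"
  using gen by (simp add: generating_pair_iff)

lemma comb_cong_iff:
  "comb x y a b = comb x y c d \<longleftrightarrow> int n dvd a - c \<and> int n dvd b - d"
  by (simp add: comb_eq_iff comb_one_iff)

text \<open>With \<open>m\<close> = 2 or 3 this reduces a \<open>q\<close>-th power to finitely many
  cases.\<close>

lemma comb_mod:
  assumes "int n = m * q"
  shows "comb x y (a * q) (b * q) = comb x y (q * (a mod m)) (q * (b mod m))"
proof -
  have "a * q - q * (a mod m) = int n * (a div m)" for a
  proof -
    have "a * q - q * (a mod m) = q * (a - a mod m)" by (simp add: algebra_simps)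
    then show ?thesis by (simp add: assms minus_mod_eq_mult_div)
  qed
  then show ?thesis by (simp add: comb_cong_iff)
qed

text \<open>Cramer's rule: a determinant prime to \<open>n\<close> is invertible modulo
  \<open>n\<close>.\<close>

lemma generating_pair_comb:
  assumes "coprime (a * d - b * c) (int n)"
  shows "generating_pair G (comb x y a b) (comb x y c d)"
  unfolding generating_pair_iff
proof (intro conjI ballI)
  fix g assume "g \<in> carrier G"
  then obtain s t where g: "g = comb x y s t" using surj by blast
  let ?D = "a * d - b * c"
  obtain D' N' where "D' * ?D + N' * int n = 1"
    using assms bezout_int by (metis coprime_imp_gcd_eq_1)
  then have "?D * D' - 1 = int n * - N'" by (simp add: algebra_simps)
  then have D': "int n dvd ?D * D' - 1" by (metis dvd_triv_left)
  \<comment> \<open>The adjugate matrix applied to (\<open>s\<close>, \<open>t\<close>), times the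
    inverse \<open>D'\<close> of the determinant.\<close>
  let ?i = "D' * (d * s - c * t)" and ?j = "D' * (a * t - b * s)"
  have "(a * ?i + c * ?j) - s = (?D * D' - 1) * s" "(b * ?i + d * ?j) - t = (?D * D' - 1) * t"
    by (simp_all add: algebra_simps)
  then have "comb x y (a * ?i + c * ?j) (b * ?i + d * ?j) = g"
    unfolding g comb_cong_iff using D' by (metis dvd_mult2)
  then have "g = comb (comb x y a b) (comb x y c d) ?i ?j"
    by (simp add: comb_def[of "comb x y a b"] comb_pow comb_mult)
  then show "\<exists>i j. g = comb (comb x y a b) (comb x y c d) i j" by blast
qed auto

text \<open>Eliminating \<open>j\<close> from the two coordinate congruences leaves the determinant
  times \<open>i\<close>, and the determinant is a unit modulo \<open>n\<close>.\<close>

lemma comb_pow_disjoint: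
  assumes g: "g = comb x y (a * i) (b * i)" "g = comb x y (c * j) (d * j)"
    and cop: "coprime (a * d - b * c) (int n)"
  shows "g = \<one>"
proof -
  have "int n dvd a * i - c * j" "int n dvd b * i - d * j"
    using g comb_cong_iff by metis+
  then have "int n dvd d * (a * i - c * j) - c * (b * i - d * j)"
    by (metis dvd_diff dvd_mult)
  also have "\<dots> = (a * d - b * c) * i" by (simp add: algebra_simps)
  finally have "int n dvd i" using cop
    by (metis coprime_commute coprime_dvd_mult_right_iff)
  then show ?thesis by (simp add: g(1) comb_one_iff)
qed

text \<open>The second pair has determinant -3, a unit as 3 does not divide \<open>n\<close>. The
  nine determinants between a line of one pair and a line of the other are all 1, -1, 2 or -2, units
  as \<open>n\<close> is odd.\<close>

lemma two_pairs:
  assumes "odd n" "\<not> 3 dvd n"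
  shows "generating_pair G (comb x y 1 2) (comb x y 1 (-1))"
    and "Sigma_set G x y \<inter> Sigma_set G (comb x y 1 2) (comb x y 1 (-1)) = {\<one>}"
proof -
  have "coprime 3 n" using assms by (intro prime_imp_coprime) auto
  then have "coprime (-3::int) (int n)"
    by (metis coprime_int_iff coprime_minus_left_iff of_nat_numeral)
  then show "generating_pair G (comb x y 1 2) (comb x y 1 (-1))"
    by (intro generating_pair_comb) simp
  \<comment> \<open>Here \<open>x\<close> and \<open>y\<close> are written in coordinates so that
    all nine cases have the form of \<open>comb_pow_disjoint\<close>.\<close>
  have "g = \<one>" if "g \<in> Sigma_set G (comb x y 1 0) (comb x y 0 1)"
    "g \<in> Sigma_set G (comb x y 1 2) (comb x y 1 (-1))" for g
    using that unfolding Sigma_set_comb_iff[OF fin xy_closed]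
    by (elim disjE exE) (erule (1) comb_pow_disjoint, simp add: assms(1))+
  then show "Sigma_set G x y \<inter> Sigma_set G (comb x y 1 2) (comb x y 1 (-1)) = {\<one>}"
    using one_in_Sigma_set[OF fin] by auto
qed

text \<open>For odd \<open>n\<close> the lines of (1,0), (0,1), (1,1), (1,-1) meet pairwise
  trivially, and each of the four pairs omits exactly one of them: (1,-1), (1,1), (0,1) and (1,0) in
  this order.\<close>

lemma four_pairs:
  assumes "odd n"
  shows "generating_pair G (comb x y 1 0) (comb x y 0 (-1))"
    and "generating_pair G (comb x y 1 1) (comb x y 1 (-1))"
    and "generating_pair G (comb x y 1 1) (comb x y (-1) 1)"
    and "Sigma_set G x y \<inter> Sigma_set G (comb x y 1 0) (comb x y 0 (-1)) \<inter>
      Sigma_set G (comb x y 1 1) (comb x y 1 (-1)) \<inter>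
      Sigma_set G (comb x y 1 1) (comb x y (-1) 1) = {\<one>}"
proof -
  show "generating_pair G (comb x y 1 0) (comb x y 0 (-1))"
    "generating_pair G (comb x y 1 1) (comb x y 1 (-1))"
    "generating_pair G (comb x y 1 1) (comb x y (-1) 1)"
    by (intro generating_pair_comb; simp add: assms)+
  have "g = \<one>" if "g \<in> Sigma_set G (comb x y 1 0) (comb x y 0 1)"
    "g \<in> Sigma_set G (comb x y 1 0) (comb x y 0 (-1))"
    "g \<in> Sigma_set G (comb x y 1 1) (comb x y 1 (-1))"
    "g \<in> Sigma_set G (comb x y 1 1) (comb x y (-1) 1)" for g
  proof (rule ccontr)
    assume "g \<noteq> \<one>"
    \<comment> \<open>\<open>L a b\<close> says that \<open>g\<close> lies on the line of
      (\<open>a\<close>, \<open>b\<close>).\<close>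
    define L where "L a b \<longleftrightarrow> (\<exists>k. g = comb x y (a * k) (b * k))" for a b
    have D: "\<not> (L a b \<and> L c d)" if "coprime (a * d - b * c) (int n)" for a b c d
      using comb_pow_disjoint[OF _ _ that] \<open>g \<noteq> \<one>\<close> unfolding L_def by blast
    have "L 1 0 \<or> L 0 1 \<or> L 1 1" "L 1 0 \<or> L 0 (-1) \<or> L 1 (-1)"
      "L 1 1 \<or> L 1 (-1) \<or> L 2 0" "L 1 1 \<or> L (-1) 1 \<or> L 0 2"
      using that unfolding Sigma_set_comb_iff[OF fin xy_closed] L_def[symmetric] by simp_all
    \<comment> \<open>The three alternatives of the first pair are refuted in turn:
      \<open>L 1 0\<close> by the fourth pair, \<open>L 0 1\<close> by the third,
      \<open>L 1 1\<close> by the second.\<close>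
    moreover have "\<not> (L 1 0 \<and> L 1 1)" "\<not> (L 1 0 \<and> L (-1) 1)" "\<not> (L 1 0 \<and> L 0 2)"
      "\<not> (L 0 1 \<and> L 1 1)" "\<not> (L 0 1 \<and> L 1 (-1))" "\<not> (L 0 1 \<and> L 2 0)"
      "\<not> (L 1 1 \<and> L 1 0)" "\<not> (L 1 1 \<and> L 0 (-1))" "\<not> (L 1 1 \<and> L 1 (-1))"
      by (rule D; simp add: assms)+
    ultimately show False by blast
  qed
  then show "Sigma_set G x y \<inter> Sigma_set G (comb x y 1 0) (comb x y 0 (-1)) \<inter>
      Sigma_set G (comb x y 1 1) (comb x y 1 (-1)) \<inter>
      Sigma_set G (comb x y 1 1) (comb x y (-1) 1) = {\<one>}"
    using one_in_Sigma_set[OF fin] by auto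
qed

end

section \<open>Abelian groups in which no non-identity element lies in every
  \<open>Sigma_set\<close>\<close>

lemma (in comm_group) pow_mult_eq_one:
  assumes "w \<in> carrier G" "w [^] (q::int) = \<one>"
  shows "w [^] (q * c) = \<one>"
  using assms by (metis int_pow_pow int_pow_one)

lemma (in comm_group) comb_swap:
  assumes "x \<in> carrier G" "y \<in> carrier G"
  shows "comb x y a b = comb y x b a"
  using assms by (simp add: comb_def m_comm)

lemma generating_pair_swap: "generating_pair G x y \<longleftrightarrow> generating_pair G y x"
  by (auto simp: generating_pair_def insert_commute)

text \<open>\<open>no_common\<close> negates the first branch of \<open>beauville_dim\<close>; the
  last three assumptions characterize \<open>e\<close> as the exponent.\<close>

locale no_common_element = comm_group G for G (structure) +
  fixes e :: nat
  assumes fin: "finite (carrier G)"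
    and no_common: "\<And>g. g \<in> carrier G \<Longrightarrow> g \<noteq> \<one> \<Longrightarrow> \<exists>x y. generating_pair G x y \<and> g \<notin> Sigma_set G x y"
    and e_pos: "e > 0"
    and pow_e: "\<And>g. g \<in> carrier G \<Longrightarrow> g [^] int e = \<one>"
    and e_min: "\<And>m::int. 0 < m \<Longrightarrow> m < int e \<Longrightarrow> \<exists>g\<in>carrier G. g [^] m \<noteq> \<one>"
begin

text \<open>Otherwise \<open>w [^] q\<close> generates all \<open>q\<close>-th powers. A generating
  pair whose \<open>Sigma_set\<close> misses it must consist of elements with trivial
  \<open>q\<close>-th power, so \<open>q\<close> < \<open>e\<close> would kill the whole
  group.\<close>

lemma pow_image_not_cyclic:
  fixes p q :: int
  assumes p: "Factorial_Ring.prime p" "int e = p * q" and w: "w \<in> carrier G"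
    and cyc: "\<And>g. g \<in> carrier G \<Longrightarrow> \<exists>c. g [^] q = w [^] (q * c)"
  shows False
proof -
  have "0 < p * q" "1 < p" using p e_pos prime_gt_1_int by auto
  then have q: "0 < q" "q < int e" by (simp_all add: p(2) zero_less_mult_iff)
  obtain h where h: "h \<in> carrier G" "h [^] q \<noteq> \<one>" using e_min[OF q] by blast
  have "w [^] q \<noteq> \<one>" using cyc[OF h(1)] h(2) w pow_mult_eq_one by metis
  then obtain x y where xy: "generating_pair G x y" "w [^] q \<notin> Sigma_set G x y"
    using no_common w by blast
  have [simp]: "x \<in> carrier G" "y \<in> carrier G" using xy by (auto simp: generating_pair_def)
  \<comment> \<open>If \<open>c\<close> is invertible modulo \<open>p\<close>, then
    \<open>w [^] q\<close> can be recovered as a power of \<open>z [^] q\<close>.\<close>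
  have unit: "\<exists>k::int. w [^] q = z [^] k"
    if "z \<in> carrier G" "z [^] q = w [^] (q * c)" "\<not> p dvd c" for z c
  proof -
    have "gcd c p = 1" using that p prime_imp_coprime[of p c] by (simp add: coprime_commute)
    then obtain s t where st: "s * c + t * p = 1" using bezout_int[of c p] by metis
    have "q * c * s + int e * t = q * (s * c + t * p)" by (simp add: p(2) algebra_simps)
    then have "w [^] q = w [^] (q * c * s + int e * t)" by (simp add: st)
    also have "\<dots> = (w [^] (q * c)) [^] s"
      using w pow_mult_eq_one[OF w pow_e[OF w]] by (simp add: int_pow_mult int_pow_pow)
    also have "\<dots> = (z [^] q) [^] s" by (simp only: that)
    also have "\<dots> = z [^] (q * s)" using that(1) by (simp add: int_pow_pow)
    finally show ?thesis by blast
  qed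
  have one: "z [^] q = \<one>" if "z = x \<or> z = y" for z
  proof -
    have z: "z \<in> carrier G" using that by auto
    then obtain c where c: "z [^] q = w [^] (q * c)" using cyc by blast
    have "\<nexists>k::int. w [^] q = z [^] k" using that xy(2) fin by (auto simp: Sigma_set_iff)
    then have "p dvd c" using unit[OF z c] by blast
    then obtain c' where "c = p * c'" by blast
    then have "z [^] q = w [^] (int e * c')" using c p(2) by (simp add: mult_ac)
    then show ?thesis using pow_mult_eq_one[OF w pow_e[OF w]] by simp
  qed
  obtain i j where "h = comb x y i j" using h xy by (auto simp: generating_pair_iff)
  then have "h [^] q = x [^] (q * i) \<otimes> y [^] (q * j)"
    by (simp add: comb_pow) (simp add: comb_def mult.commute)
  then show False using h(2) one by (simp add: pow_mult_eq_one)
qed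

text \<open>If \<open>a\<close> were invertible modulo \<open>p\<close>, the relation would express
  \<open>x [^] q\<close> through \<open>y [^] q\<close>, making the image of the \<open>q\<close>-th
  power map cyclic.\<close>

lemma socle_independent:
  fixes p q :: int
  assumes p: "Factorial_Ring.prime p" "int e = p * q" and gen: "generating_pair G x y"
    and eq: "comb x y (q * a) (q * b) = \<one>"
  shows "p dvd a"
proof (rule ccontr)
  assume "\<not> p dvd a"
  have [simp]: "x \<in> carrier G" "y \<in> carrier G" using gen by (auto simp: generating_pair_def)
  have "gcd a p = 1" using \<open>\<not> p dvd a\<close> p prime_imp_coprime[of p a] by (simp add: coprime_commute)
  then obtain s t where st: "s * a + t * p = 1" using bezout_int[of a p] by metis
  show False
  proof (rule pow_image_not_cyclic[OF p, of y])
    fix g assume "g \<in> carrier G"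
    then obtain i j where g: "g = comb x y i j" using gen by (auto simp: generating_pair_iff)
    \<comment> \<open>The Bezout identity splits the exponent of \<open>x\<close> into a part
      removed by the relation \<open>eq\<close> and a multiple of \<open>e\<close>.\<close>
    have i: "i * q = q * a * (s * i) + int e * (t * i)"
    proof -
      have "q * a * (s * i) + int e * (t * i) = i * q * (s * a + t * p)"
        by (simp add: p(2) algebra_simps)
      then show ?thesis by (simp add: st)
    qed
    have "comb x y (i * q) (q * b * (s * i)) =
      comb x y (q * a) (q * b) [^] (s * i) \<otimes> comb x y (int e * (t * i)) 0"
      by (subst i) (simp add: comb_pow comb_mult)
    also have "\<dots> = \<one>"
      by (simp add: eq comb_def[of x y "int e * (t * i)"] pow_mult_eq_one pow_e)
    finally have "comb x y (i * q) (j * q) = comb x y 0 (j * q - q * b * (s * i))"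
      by (subst comb_eq_iff) simp_all
    also have "\<dots> = y [^] (q * (j - b * (s * i)))"
      by (simp add: comb_def algebra_simps)
    finally show "\<exists>c. g [^] q = y [^] (q * c)"
      unfolding g by (auto simp: comb_pow)
  qed auto
qed

text \<open>A relation is divided by the common divisor \<open>t\<close> of its exponents and
  \<open>e\<close>. If \<open>t\<close> were a proper divisor of \<open>e\<close>, a suitable power
  of the relation would lie among the \<open>e/p\<close>-th powers, and
  \<open>socle_independent\<close> would yield a larger common divisor.\<close>

lemma homocyclic:
  assumes gen: "generating_pair G x y"
  shows "homocyclic_basis G x y e"
proof unfold_locales
  have [simp]: "x \<in> carrier G" "y \<in> carrier G" using gen by (auto simp: generating_pair_def)
  fix a b
  show "comb x y a b = \<one> \<longleftrightarrow> int e dvd a \<and> int e dvd b"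
  proof
    assume "int e dvd a \<and> int e dvd b"
    then show "comb x y a b = \<one>"
      by (auto simp: comb_def pow_mult_eq_one pow_e elim!: dvdE)
  next
    assume one: "comb x y a b = \<one>"
    define t where "t = gcd (gcd a b) (int e)"
    have t: "t > 0" using e_pos by (simp add: t_def)
    obtain a' b' s where abs: "a = t * a'" "b = t * b'" "int e = t * s"
      unfolding t_def by (meson dvdE gcd_dvd1 gcd_dvd2 dvd_trans)
    have "is_unit s"
    proof (rule ccontr)
      assume "\<not> is_unit s"
      moreover have "s \<noteq> 0" using abs e_pos by auto
      ultimately obtain p where p: "Factorial_Ring.prime p" "p dvd s" by (meson prime_divisor_exists)
      then obtain r where r: "s = p * r" by blast
      have e: "int e = p * (t * r)" by (simp add: abs r mult_ac)
      have "comb x y (t * r * a') (t * r * b') = comb x y a b [^] r"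
        by (simp add: comb_pow abs mult_ac)
      then have eq: "comb x y (t * r * a') (t * r * b') = \<one>" by (simp add: one)
      have "p dvd a'" by (rule socle_independent[OF p(1) e gen eq])
      \<comment> \<open>The same argument with \<open>x\<close> and \<open>y\<close>
        exchanged.\<close>
      moreover have "p dvd b'"
        using eq gen by (intro socle_independent[OF p(1) e, of y x])
          (simp_all add: comb_swap[of y x] generating_pair_swap)
      ultimately have "t * p dvd gcd (gcd a b) (int e)" using abs r by auto
      then have "t * p dvd t * 1" by (simp add: t_def)
      then have "p dvd 1" using t by (simp only: dvd_mult_cancel_left) auto
      then show False using p(1) by auto
    qed
    then show "int e dvd a \<and> int e dvd b"
      using abs unit_imp_dvd[of s] by (metis dvd_refl mult_dvd_mono)
  qed
qed (rule fin gen)+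

text \<open>In a basis \<open>u\<close>, \<open>v\<close> the only involutions are the
  \<open>e/2\<close>-th powers of \<open>u\<close>, \<open>v\<close> and their product, all of which
  lie in \<open>Sigma_set G u v\<close>.\<close>

lemma odd_e:
  assumes "generating_pair G x y"
  shows "odd e"
proof
  assume "even e"
  then obtain q' where q': "e = 2 * q'" by blast
  define q where "q = int q'"
  have q: "int e = 2 * q" "0 < q" using q' e_pos by (auto simp: q_def)
  interpret B: homocyclic_basis G x y e by (rule homocyclic[OF assms])
  have ne: "x [^] q \<noteq> \<one>"
    using B.comb_one_iff[of q 0] q zdvd_imp_le[of "2 * q" q] by (auto simp: comb_def)
  obtain u v where uv: "generating_pair G u v" "x [^] q \<notin> Sigma_set G u v"
    using no_common[OF _ ne] by auto
  interpret U: homocyclic_basis G u v e by (rule homocyclic[OF uv(1)])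
  obtain a b where ab: "x = comb u v a b" using U.surj[OF B.xy_closed(1)] by blast
  have red: "x [^] q = comb u v (q * (a mod 2)) (q * (b mod 2))"
    using U.comb_mod[OF q(1)] by (simp add: ab comb_pow)
  have "a mod 2 = 0 \<or> a mod 2 = 1" "b mod 2 = 0 \<or> b mod 2 = 1" by auto
  moreover have "comb u v 0 (q * 1) \<in> Sigma_set G u v" "comb u v (q * 1) 0 \<in> Sigma_set G u v"
    "comb u v (q * 1) (q * 1) \<in> Sigma_set G u v"
    using fin by (simp_all add: comb_in_Sigma_set)
  ultimately show False using red ne uv(2) by auto
qed

text \<open>Of the nine coordinate pairs modulo 3, those with a zero or with equal entries lie in
  the \<open>Sigma_set\<close>; (1,2) and (2,1) remain.\<close>

lemma missed_socle_elements:
  assumes e: "int e = 3 * q" and uv: "generating_pair G u v"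
    and g: "g \<in> carrier G" "g [^] q \<notin> Sigma_set G u v"
  shows "g [^] q = comb u v q (- q) \<or> g [^] q = comb u v (- q) q"
proof -
  interpret U: homocyclic_basis G u v e by (rule homocyclic[OF uv])
  obtain a b where "g = comb u v a b" using U.surj[OF g(1)] by auto
  then have red: "g [^] q = comb u v (q * (a mod 3)) (q * (b mod 3))"
    using U.comb_mod[OF e] by (simp add: comb_pow)
  have "comb u v q (q * 2) = comb u v q (- q)" "comb u v (q * 2) q = comb u v (- q) q"
    by (simp_all add: U.comb_cong_iff e)
  moreover have "a mod 3 = 0 \<or> a mod 3 = 1 \<or> a mod 3 = 2" "b mod 3 = 0 \<or> b mod 3 = 1 \<or> b mod 3 = 2"
    by auto
  ultimately show ?thesis
    using red g(2) comb_in_Sigma_set[OF fin U.xy_closed] one_in_Sigma_set[OF fin U.xy_closed]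
    by auto
qed

text \<open>\<open>P\<close> contains one generator of each subgroup of order 3. The two elements
  that a \<open>Sigma_set\<close> may miss are mutually inverse, whereas no product of two elements
  of \<open>P\<close> is trivial.\<close>

lemma four_socle_elements:
  assumes e: "int e = 3 * q" and xy: "generating_pair G x y"
  defines "P \<equiv> {comb x y q 0, comb x y 0 q, comb x y q q, comb x y q (- q)}"
  shows "card P = 4" "\<one> \<notin> P"
    and "\<And>u v. generating_pair G u v \<Longrightarrow> card (P - Sigma_set G u v) \<le> 1"
proof -
  interpret B: homocyclic_basis G x y e by (rule homocyclic[OF xy])
  have q: "q > 0" using e e_pos by simp
  have nd: "\<not> int e dvd q" "\<not> int e dvd 2 * q"
    using q e zdvd_imp_le[of "int e" q] zdvd_imp_le[of "int e" "2 * q"] by linarith+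
  have "q + q = 2 * q" "- q - q = - (2 * q)" by simp_all
  then have nd': "\<not> int e dvd q + q" "\<not> int e dvd - q - q"
    using nd(2) by (simp_all only: dvd_minus_iff not_False_eq_True)
  show "card P = 4"
    unfolding P_def by (simp add: B.comb_cong_iff nd nd')
  have mult_ne: "g \<otimes> h \<noteq> \<one>" if "g \<in> P" "h \<in> P" for g h
    using that unfolding P_def by (auto simp: comb_mult B.comb_one_iff nd nd')
  \<comment> \<open>Otherwise \<open>mult_ne\<close> would fail for the identity times
    itself.\<close>
  then show "\<one> \<notin> P" by fastforce
  fix u v assume uv: "generating_pair G u v"
  then have [simp]: "u \<in> carrier G" "v \<in> carrier G" by (auto simp: generating_pair_def)
  have P: "\<exists>w\<in>carrier G. g = w [^] q" if "g \<in> P" for g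
  proof -
    have "g = comb x y 1 0 [^] q \<or> g = comb x y 0 1 [^] q \<or> g = comb x y 1 1 [^] q
      \<or> g = comb x y 1 (-1) [^] q"
      using that unfolding P_def comb_pow[OF B.xy_closed] by simp
    moreover have "comb x y i j \<in> carrier G" for i j by simp
    ultimately show ?thesis by blast
  qed
  have "g = h" if "g \<in> P - Sigma_set G u v" "h \<in> P - Sigma_set G u v" for g h
  proof (rule ccontr)
    assume "g \<noteq> h"
    moreover have "g = comb u v q (- q) \<or> g = comb u v (- q) q"
      "h = comb u v q (- q) \<or> h = comb u v (- q) q"
      using missed_socle_elements[OF e uv] that P by (metis DiffD1 DiffD2)+
    ultimately have "g \<otimes> h = \<one>" by (auto simp: comb_mult)
    then show False using mult_ne that by blast
  qed
  then show "card (P - Sigma_set G u v) \<le> 1"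
    by (metis One_nat_def card_le_Suc0_iff_eq finite_Diff P_def finite.intros)
qed

end

section \<open>Bounds on the Beauville dimension\<close>

text \<open>The predicate under \<open>LEAST\<close> in \<open>beauville_dim\<close>, named so that
  it can be folded there.\<close>

definition meets_trivially :: "('a, 'b) monoid_scheme \<Rightarrow> nat \<Rightarrow> bool" where
  "meets_trivially G d \<longleftrightarrow> d \<ge> 1 \<and>
     (\<exists>x y :: nat \<Rightarrow> 'a.
        (\<forall>i\<in>{1..d}. generating_pair G (x i) (y i)) \<and>
        (\<Inter>i\<in>{1..d}. Sigma_set G (x i) (y i)) = {\<one>\<^bsub>G\<^esub>})"

text \<open>In the conventional case the value 1 is covered by \<open>d\<close> being at least
  1.\<close>

lemma beauville_dim_le:
  assumes "meets_trivially G d"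
  shows "beauville_dim G \<le> d"
  using assms unfolding beauville_dim_def meets_trivially_def[symmetric]
  by (auto simp: meets_trivially_def intro: Least_le)

lemma beauville_dim_attained:
  assumes "meets_trivially G d"
    and "\<And>g. g \<in> carrier G \<Longrightarrow> g \<noteq> \<one>\<^bsub>G\<^esub> \<Longrightarrow> \<exists>x y. generating_pair G x y \<and> g \<notin> Sigma_set G x y"
  shows "meets_trivially G (beauville_dim G)"
proof -
  have "beauville_dim G = (LEAST d. meets_trivially G d)"
    using assms(2) unfolding beauville_dim_def meets_trivially_def[symmetric] by auto
  then show ?thesis using LeastI[of "meets_trivially G", OF assms(1)] by simp
qed

context homocyclic_basis
begin

lemma meets_trivially_4:
  assumes "odd n"
  shows "meets_trivially G 4"
proof -
  \<comment> \<open>Indices 1 to 4 run through \<open>x\<close>, \<open>y\<close> and the three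
    pairs of \<open>four_pairs\<close>.\<close>
  define u where "u i = (if i \<le> 2 then comb x y 1 0 else comb x y 1 1)" for i :: nat
  define v where "v i = (if i = 1 then y else if i = 2 then comb x y 0 (-1)
    else if i = 3 then comb x y 1 (-1) else comb x y (-1) 1)" for i :: nat
  have "{1..4::nat} = {1, 2, 3, 4}" by auto
  then show ?thesis
    unfolding meets_trivially_def using four_pairs[OF assms] gen
    by (intro conjI exI[of _ u] exI[of _ v]) (auto simp: u_def v_def)
qed

lemma meets_trivially_2:
  assumes "odd n" "\<not> 3 dvd n"
  shows "meets_trivially G 2"
proof -
  define u where "u i = (if i = 1 then x else comb x y 1 2)" for i :: nat
  define v where "v i = (if i = 1 then y else comb x y 1 (-1))" for i :: nat
  have "{1..2::nat} = {1, 2}" by auto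
  then show ?thesis
    unfolding meets_trivially_def using two_pairs[OF assms] gen
    by (intro conjI exI[of _ u] exI[of _ v]) (auto simp: u_def v_def)
qed

text \<open>\<open>two_pairs\<close> bounds the dimension by 2 and also excludes the conventional
  value 1. A single trivial \<open>Sigma_set\<close> would force the group to be trivial.\<close>

lemma beauville:
  assumes "odd n" "\<not> 3 dvd n" "n > 1"
  shows "beauville_group G"
proof -
  have "meets_trivially G (beauville_dim G)"
    using meets_trivially_2[OF assms(1,2)] two_pairs[OF assms(1,2)] gen
    by (intro beauville_dim_attained) blast+
  moreover have "\<not> meets_trivially G 1"
  proof
    assume "meets_trivially G 1"
    then obtain u v where uv: "generating_pair G u v" "Sigma_set G u v = {\<one>}"
      by (auto simp: meets_trivially_def)
    then have [simp]: "u \<in> carrier G" "v \<in> carrier G" by (auto simp: generating_pair_def)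
    have "u = \<one>" "v = \<one>"
      using uv(2) comb_in_Sigma_set(1,2)[OF fin, of u v 1] by auto
    then have "x = \<one>"
      using uv by (auto simp: generating_pair_iff comb_def)
    then show False
      using comb_one_iff[of 1 0] assms(3) by simp
  qed
  moreover have "beauville_dim G \<ge> 1" "beauville_dim G \<le> 2"
    using calculation(1) beauville_dim_le[OF meets_trivially_2[OF assms(1,2)]]
    by (auto simp: meets_trivially_def)
  ultimately have "beauville_dim G = 2"
    by (metis One_nat_def Suc_1 le_SucE le_antisym)
  then show ?thesis by (simp add: beauville_group_def fin is_group)
qed

section \<open>Splitting along a coprime factorization of the exponent\<close>

text \<open>The \<open>m\<close>-th powers of the basis span a copy of C_N x C_N, complementary to
  \<open>K\<close> by Bezout. \<open>K\<close> is a bare monoid record because \<open>G\<close> may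
  carry further fields.\<close>

lemma primary_splitting:
  assumes n: "n = N * m" "coprime N m" "N > 0" "m > 0"
  defines "K \<equiv> \<lparr>carrier = generate G {x [^] int N, y [^] int N}, monoid.mult = monoid.mult G, one = \<one>\<rparr>"
  shows "homocyclic_basis K (x [^] int N) (y [^] int N) m"
    and "G \<cong> integer_mod_group N \<times>\<times> integer_mod_group N \<times>\<times> K"
proof -
  have comb_N: "comb (x [^] int N) (y [^] int N) a b = comb x y (int N * a) (int N * b)" for a b
    by (simp add: comb_def int_pow_pow)
  have sub: "subgroup (carrier K) G"
    unfolding K_def by (simp add: generate_is_subgroup)
  have K: "carrier K = {comb x y (int N * a) (int N * b) | a b. True}"
    unfolding K_def by (simp add: generate_pair_eq comb_N)
  have KG: "carrier K \<subseteq> carrier G" using sub by (rule subgroup.subset)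
  interpret K: comm_group K
  proof (rule comm_groupI)
    show "\<exists>h\<in>carrier K. h \<otimes>\<^bsub>K\<^esub> g = \<one>\<^bsub>K\<^esub>" if "g \<in> carrier K" for g
      using that KG subgroup.m_inv_closed[OF sub] by (intro bexI[of _ "inv g"]) (auto simp: K_def)
    show "g \<otimes>\<^bsub>K\<^esub> h = h \<otimes>\<^bsub>K\<^esub> g" if "g \<in> carrier K" "h \<in> carrier K" for g h
      using that KG by (auto simp: K_def intro: m_comm)
  qed (use KG subgroup.m_closed[OF sub] subgroup.one_closed[OF sub] in
      \<open>auto simp: K_def m_assoc subset_iff\<close>)
  \<comment> \<open>Integer powers agree because the inclusion of \<open>K\<close> is a
    homomorphism.\<close>
  have pow: "g [^]\<^bsub>K\<^esub> (k::int) = g [^] k" if "g \<in> carrier K" for g k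
  proof -
    have "id \<in> hom K G" using KG by (auto simp: hom_def K_def)
    from hom_int_pow[OF this that K.is_group is_group] show ?thesis by simp
  qed
  have gens: "x [^] int N \<in> carrier K" "y [^] int N \<in> carrier K"
    by (simp_all add: K_def generate.incl)
  have Kcomb: "K.comb (x [^] int N) (y [^] int N) a b = comb x y (int N * a) (int N * b)" for a b
  proof -
    have "K.comb (x [^] int N) (y [^] int N) a b = comb (x [^] int N) (y [^] int N) a b"
      using gens by (simp only: K.comb_def comb_def pow) (simp add: K_def)
    then show ?thesis by (simp only: comb_N)
  qed
  show "homocyclic_basis K (x [^] int N) (y [^] int N) m"
  proof unfold_locales
    show "finite (carrier K)" using KG fin by (rule finite_subset)
    show "generating_pair K (x [^] int N) (y [^] int N)"
      using gens by (auto simp: K.generating_pair_iff Kcomb K)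
    show "K.comb (x [^] int N) (y [^] int N) a b = \<one>\<^bsub>K\<^esub> \<longleftrightarrow> int m dvd a \<and> int m dvd b" for a b
      using n(3) unfolding Kcomb by (simp add: K_def comb_one_iff n(1))
  qed
  define f where "f = (\<lambda>(a, b, g). comb x y (int m * a) (int m * b) \<otimes> g)"
  let ?Z = "integer_mod_group N"
  have Z: "carrier ?Z = {0..<int N}" using n by (simp add: carrier_integer_mod_group)
  \<comment> \<open>Reducing an exponent modulo \<open>N\<close> changes its \<open>m\<close>-fold
    by a multiple of \<open>n\<close>, so \<open>f\<close> respects addition of residues.\<close>
  have mod: "int n dvd int m * (s mod int N) - int m * s" for s
  proof -
    have "int m * (s mod int N) - int m * s = int n * - (s div int N)"
      by (simp add: n(1) algebra_simps flip: minus_mult_div_eq_mod)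
    then show ?thesis by (metis dvd_triv_left)
  qed
  have "f \<in> iso (?Z \<times>\<times> ?Z \<times>\<times> K) G"
  proof (rule isoI)
    show "f \<in> hom (?Z \<times>\<times> ?Z \<times>\<times> K) G"
    proof (rule homI)
      fix s t assume "s \<in> carrier (?Z \<times>\<times> ?Z \<times>\<times> K)" "t \<in> carrier (?Z \<times>\<times> ?Z \<times>\<times> K)"
      then obtain a b g a' b' g' where st: "s = (a, b, g)" "t = (a', b', g')"
        "g \<in> carrier K" "g' \<in> carrier K" by (auto simp: DirProd_def)
      then have [simp]: "g \<in> carrier G" "g' \<in> carrier G" using KG by auto
      have "comb x y (int m * ((a + a') mod int N)) (int m * ((b + b') mod int N)) =
        comb x y (int m * a) (int m * b) \<otimes> comb x y (int m * a') (int m * b')"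
        using mod by (simp add: comb_mult comb_cong_iff flip: distrib_left)
      then show "f (s \<otimes>\<^bsub>?Z \<times>\<times> ?Z \<times>\<times> K\<^esub> t) = f s \<otimes> f t"
        by (simp add: st f_def) (simp add: K_def m_ac)
    qed (use KG in \<open>auto simp: f_def DirProd_def\<close>)
    show "bij_betw f (carrier (?Z \<times>\<times> ?Z \<times>\<times> K)) (carrier G)"
      unfolding bij_betw_def
    proof (intro conjI equalityI subsetI)
      show "inj_on f (carrier (?Z \<times>\<times> ?Z \<times>\<times> K))"
      proof (rule inj_onI)
        fix s t assume "s \<in> carrier (?Z \<times>\<times> ?Z \<times>\<times> K)" "t \<in> carrier (?Z \<times>\<times> ?Z \<times>\<times> K)"
          and eq: "f s = f t"
        then obtain a b g a' b' g' where st: "s = (a, b, g)" "t = (a', b', g')"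
          "g \<in> carrier K" "g' \<in> carrier K"
          and r: "a \<in> {0..<int N}" "b \<in> {0..<int N}" "a' \<in> {0..<int N}" "b' \<in> {0..<int N}"
          by (auto simp: DirProd_def Z)
        have [simp]: "g \<in> carrier G" "g' \<in> carrier G" using st KG by auto
        obtain c d c' d' where g: "g = comb x y (int N * c) (int N * d)"
          "g' = comb x y (int N * c') (int N * d')" using st by (auto simp: K)
        have dvd: "int n dvd (int m * a + int N * c) - (int m * a' + int N * c')"
          "int n dvd (int m * b + int N * d) - (int m * b' + int N * d')"
          using eq by (auto simp: st f_def g comb_mult comb_cong_iff)
        \<comment> \<open>Modulo \<open>N\<close> the contribution of \<open>K\<close> vanishes and
          \<open>m\<close> is invertible.\<close>
        have cancel: "a = a'" if "int n dvd (int m * a + int N * c) - (int m * a' + int N * c')"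
          "a \<in> {0..<int N}" "a' \<in> {0..<int N}" for a c a' c'
        proof -
          have "int N dvd (int m * a + int N * c) - (int m * a' + int N * c')"
            using that(1) by (simp add: n(1)) (meson dvd_mult_left)
          moreover have "(int m * a + int N * c) - (int m * a' + int N * c') =
            int m * (a - a') + int N * (c - c')" by (simp add: algebra_simps)
          ultimately have "int N dvd int m * (a - a')"
            by (metis dvd_add_left_iff dvd_triv_left)
          then have "int N dvd a - a'"
            using n(2) by (simp add: coprime_dvd_mult_right_iff)
          then have "a mod int N = a' mod int N" by (simp add: mod_eq_dvd_iff)
          then show ?thesis using that(2,3) by simp
        qed
        have "a = a'" "b = b'" using cancel dvd r by blast+
        then show "s = t" using eq by (simp add: st f_def)
      qed
    next
      fix g assume "g \<in> carrier G"
      then obtain s t where g: "g = comb x y s t" using surj by blast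
      obtain \<alpha> \<beta> where \<alpha>\<beta>: "\<alpha> * int m + \<beta> * int N = 1"
        using n(2) bezout_int[of "int m" "int N"]
        by (metis coprime_commute coprime_imp_gcd_eq_1 coprime_int_iff)
      \<comment> \<open>Bezout splits \<open>s\<close> into a multiple of \<open>m\<close>, taken by
        the cyclic factors, and a multiple of \<open>N\<close>, taken by \<open>K\<close>.\<close>
      have split: "int n dvd s - (int m * (\<alpha> * s mod int N) + int N * (\<beta> * s))" for s
      proof -
        have eq: "s - (int m * (\<alpha> * s mod int N) + int N * (\<beta> * s)) =
          s * (1 - (\<alpha> * int m + \<beta> * int N)) - (int m * (\<alpha> * s mod int N) - int m * (\<alpha> * s))"
          by (simp add: algebra_simps)
        show ?thesis unfolding eq \<alpha>\<beta> by (rule dvd_diff[OF _ mod]) simp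
      qed
      let ?h = "comb x y (int N * (\<beta> * s)) (int N * (\<beta> * t))"
      have "g = f (\<alpha> * s mod int N, \<alpha> * t mod int N, ?h)"
        unfolding g f_def prod.case comb_mult[OF xy_closed] comb_cong_iff
        by (intro conjI split)
      moreover have "(\<alpha> * s mod int N, \<alpha> * t mod int N, ?h) \<in> carrier (?Z \<times>\<times> ?Z \<times>\<times> K)"
      proof -
        have "?h \<in> carrier K" unfolding K by blast
        then show ?thesis using n(3) by (simp add: Z)
      qed
      ultimately show "g \<in> f ` carrier (?Z \<times>\<times> ?Z \<times>\<times> K)" by blast
    qed (use KG in \<open>auto simp: f_def DirProd_def\<close>)
  qed
  then have "(?Z \<times>\<times> ?Z \<times>\<times> K) \<cong> G" by (rule is_isoI)
  moreover have "Group.group (?Z \<times>\<times> ?Z \<times>\<times> K)"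
    by (intro DirProd_group group_integer_mod_group K.is_group)
  ultimately show "G \<cong> ?Z \<times>\<times> ?Z \<times>\<times> K"
    by (metis group.iso_sym)
qed

end

section \<open>Existence of the exponent and assembly of the theorem\<close>

lemma (in comm_group) least_exponent:
  assumes "finite (carrier G)"
  obtains e :: nat where "e > 0" "\<And>g. g \<in> carrier G \<Longrightarrow> g [^] int e = \<one>"
    "\<And>m::int. 0 < m \<Longrightarrow> m < int e \<Longrightarrow> \<exists>g\<in>carrier G. g [^] m \<noteq> \<one>"
proof -
  define Q where "Q e \<longleftrightarrow> e > 0 \<and> (\<forall>g\<in>carrier G. g [^] int e = \<one>)" for e :: nat
  have "Q (order G)"
    using assms by (simp add: Q_def order_gt_0_iff_finite int_pow_int pow_order_eq_1)
  then have "Q (Least Q)" by (rule LeastI)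
  moreover have "\<exists>g\<in>carrier G. g [^] m \<noteq> \<one>" if "0 < m" "m < int (Least Q)" for m :: int
  proof -
    have "\<not> Q (nat m)" using that by (intro not_less_Least) linarith
    then show ?thesis using that by (simp add: Q_def)
  qed
  ultimately show ?thesis using that[of "Least Q"] by (auto simp: Q_def)
qed

theorem theorem2p9:
  fixes H :: "('a, 'b) monoid_scheme"
  assumes "comm_group H"
    and "finite (carrier H)"
    and "beauville_dim H > 2"
  shows "beauville_dim H = 4 \<and>
    (\<exists>(n :: nat) (G :: 'a monoid).
       (\<exists>k > 0. n = 3 ^ k) \<and>
       (trivial_group G \<or> (comm_group G \<and> beauville_group G)) \<and>
       H \<cong> integer_mod_group n \<times>\<times> integer_mod_group n \<times>\<times> G)"
proof -
  interpret H: comm_group H by fact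
  have no_common: "\<exists>x y. generating_pair H x y \<and> g \<notin> Sigma_set H x y"
    if "g \<in> carrier H" "g \<noteq> \<one>\<^bsub>H\<^esub>" for g
    using that assms(3) unfolding beauville_dim_def by (auto split: if_splits)
  obtain e where e: "e > 0" "\<And>g. g \<in> carrier H \<Longrightarrow> g [^]\<^bsub>H\<^esub> int e = \<one>\<^bsub>H\<^esub>"
    "\<And>m::int. 0 < m \<Longrightarrow> m < int e \<Longrightarrow> \<exists>g\<in>carrier H. g [^]\<^bsub>H\<^esub> m \<noteq> \<one>\<^bsub>H\<^esub>"
    using H.least_exponent[OF assms(2)] by blast
  interpret H: no_common_element H e
    by unfold_locales (use assms(2) no_common e in auto)
  \<comment> \<open>\<open>no_common\<close> yields a generating pair only from a non-identity
    element, so the trivial group is treated apart.\<close>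
  obtain x y where xy: "generating_pair H x y"
  proof (cases "carrier H = {\<one>\<^bsub>H\<^esub>}")
    case True
    then have "generating_pair H \<one>\<^bsub>H\<^esub> \<one>\<^bsub>H\<^esub>"
      using H.comb_simps(1)[of "\<one>\<^bsub>H\<^esub>" "\<one>\<^bsub>H\<^esub>"] by (metis H.generating_pair_iff H.one_closed singletonD)
    then show ?thesis by (rule that)
  next
    case False
    then show ?thesis using no_common that by blast
  qed
  interpret B: homocyclic_basis H x y e by (rule H.homocyclic[OF xy])
  have odd: "odd e" by (rule H.odd_e[OF xy])
  \<comment> \<open>Otherwise two pairs would suffice, against dimension greater than 2.\<close>
  have "3 dvd e"
    using B.meets_trivially_2[OF odd] beauville_dim_le assms(3) by (metis not_le)
  then obtain q where q: "int e = 3 * q"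
    by (metis dvdE of_nat_mult of_nat_numeral)
  note four = B.meets_trivially_4[OF odd]
  define P where "P = {H.comb x y q 0, H.comb x y 0 q, H.comb x y q q, H.comb x y q (- q)}"
  note P = H.four_socle_elements[OF q xy, folded P_def]
  let ?d = "beauville_dim H"
  obtain u v where uv: "\<And>i. i \<in> {1..?d} \<Longrightarrow> generating_pair H (u i) (v i)"
    "(\<Inter>i\<in>{1..?d}. Sigma_set H (u i) (v i)) = {\<one>\<^bsub>H\<^esub>}"
    using beauville_dim_attained[OF four no_common] unfolding meets_trivially_def by blast
  \<comment> \<open>Every element of \<open>P\<close> is missed by some \<open>Sigma_set\<close> of
    an optimal family, and each set misses at most one, so at least four sets occur.\<close>
  have "P \<subseteq> (\<Union>i\<in>{1..?d}. P - Sigma_set H (u i) (v i))"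
  proof
    fix g assume g: "g \<in> P"
    then have "g \<notin> (\<Inter>i\<in>{1..?d}. Sigma_set H (u i) (v i))"
      unfolding uv(2) using P(2) by auto
    then show "g \<in> (\<Union>i\<in>{1..?d}. P - Sigma_set H (u i) (v i))"
      using g by simp
  qed
  then have "card P \<le> card (\<Union>i\<in>{1..?d}. P - Sigma_set H (u i) (v i))"
    by (intro card_mono) (auto simp: P_def)
  also have "\<dots> \<le> (\<Sum>i\<in>{1..?d}. card (P - Sigma_set H (u i) (v i)))"
    by (intro card_UN_le) simp
  also have "\<dots> \<le> (\<Sum>i\<in>{1..?d}. 1)"
    using uv(1) P(3) by (intro sum_mono) blast
  finally have "?d \<ge> 4" using P(1) by simp
  then have dim: "?d = 4" using beauville_dim_le[OF four] by simp
  \<comment> \<open>The 3-part of \<open>e\<close> gives the cyclic factors; the cofactor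
    \<open>m\<close> is the exponent of the remaining factor \<open>K\<close>.\<close>
  obtain m where m: "e = 3 ^ multiplicity 3 e * m" "\<not> 3 dvd m"
    using multiplicity_decompose'[of e 3] e(1) by auto
  define k where "k = multiplicity 3 e"
  have em: "e = 3 ^ k * m" using m(1) by (simp add: k_def)
  have "k > 0" using \<open>3 dvd e\<close> m(2) em by (cases k) auto
  have "coprime (3 ^ k) m" using m(2) prime_imp_coprime[of 3 m] by auto
  have "m > 0" "odd m" using em e(1) odd by (auto intro: Nat.gr0I)
  define K where "K = \<lparr>carrier = generate H {x [^]\<^bsub>H\<^esub> int (3 ^ k), y [^]\<^bsub>H\<^esub> int (3 ^ k)},
    monoid.mult = monoid.mult H, one = \<one>\<^bsub>H\<^esub>\<rparr>"
  note K = B.primary_splitting[OF em \<open>coprime (3 ^ k) m\<close> _ \<open>m > 0\<close>, folded K_def, simplified]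
  interpret K: homocyclic_basis K "x [^]\<^bsub>H\<^esub> int (3 ^ k)" "y [^]\<^bsub>H\<^esub> int (3 ^ k)" m
    using K(1) by simp
  \<comment> \<open>\<open>m\<close> is odd and prime to 3, so \<open>K\<close> is Beauville unless
    \<open>m\<close> = 1.\<close>
  have "trivial_group K \<or> beauville_group K"
  proof (cases "m = 1")
    case True
    then have "carrier K = {\<one>\<^bsub>K\<^esub>}"
      using K.surj K.comb_one_iff by fastforce
    then show ?thesis by (simp add: trivial_group_def K.is_group)
  next
    case False
    then show ?thesis using K.beauville \<open>odd m\<close> m(2) \<open>m > 0\<close> by simp
  qed
  then show ?thesis
    using dim \<open>k > 0\<close> K(2) K.comm_group_axioms by blast
qed

end
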